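(* Let $\tilde\eta,\tilde\nu,\tilde\tau$ be non-negative functions, analytic in a neighborhood of $0$, with Taylor coefficients $\eta_i,\nu_i,\tau_i$ as in Assumption A of the context, and suppose $0<\nu_0=\tau_0$ and $\eta_0\ge\tau_0^2/2$. Consider algorithm $(\mathcal A)$ (defined in the context) with $\eta=\tilde\eta(\sqrt q)$, $\nu=\tilde\nu(\sqrt q)$, $\tau=\tilde\tau(\sqrt q)$, where $q=\mu s$. (i) Suppose that (ia) $\eta_0=\tau_0^2/2$, $\nu_1-\tau_1<\tau_0\left(\frac{\tau_0}{2}-1\right)$, and $2\eta_1<\nu_1\tau_1+\frac{\tau_0^2}{2}\left(\frac52\tau_0-2\right)$. Then there exist constants $C,C_0,C_1>0$, depending only on $(\tilde\eta,\tilde\nu,\tilde\tau)$, such that for all $0<\mu\le L$, all $f\in\mathcal S^1_{\mu,L}$, all $x_0\in\mathbb R^n$, all $0<s\le C_0\,\mu/L^2$ and all $k\ge1$, the iterates of $(\mathcal A)$ satisfy $$f(x_k)-f^*\le C\,L\,\|x_0-x^*\|^2(1-C_1\sqrt{\mu s})^k.\qquad(1)$$ (ii) Suppose that one of the following conditions holds: (iia) $\eta_0=\tau_0^2/2$, $\nu_1-\tau_1<\tau_0\left(\frac{\tau_0}{2}-1\right)$, and $2\eta_1\ge\nu_1\tau_1+\frac{\tau_0^2}{2}\left(\frac52\tau_0-2\right)$; (iib) $\eta_0>\tau_0^2/2$ and $\nu_1-\tau_1<(\tau_0-1)\tau_0-\eta_0$; (iic) $\eta_0>\tau_0^2/2$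 and $(\tau_0-1)\tau_0-\eta_0<\nu_1-\tau_1<\eta_0-\tau_0$. Then there exist constants $C,C_0,C_1>0$, depending only on $(\tilde\eta,\tilde\nu,\tilde\tau)$, such that for all $0<\mu\le L$, all $f\in\mathcal S^1_{\mu,L}$, all $x_0\in\mathbb R^n$, all $0<s\le C_0/L$ and all $k\ge1$, the iterates of $(\mathcal A)$ satisfy (1).
   Context: For $0<\mu\le L$, $\mathcal S^1_{\mu,L}$ is the set of continuously differentiable convex functions $f:\mathbb R^n\to\mathbb R$ that are $L$-smooth ($\|\nabla f(y)-\nabla f(x)\|\le L\|y-x\|$ for all $x,y$) and $\mu$-strongly convex ($f(y)\ge f(x)+\langle\nabla f(x),y-x\rangle+\frac{\mu}{2}\|y-x\|^2$ for all $x,y$); $\|\cdot\|$ is the Euclidean norm. $x^*$ is the unique minimizer of $f$ and $f^*=f(x^* )$. For a stepsize $s>0$ put $q=\mu s$. Algorithm $(\mathcal A)$ with parameters $\eta,\nu,\tau\ge0$: starting from $x_0=z_0\in\mathbb R^n$, for $k\ge0$, $$y_{k+1}=x_k-\eta s\nabla f(x_k),$$ $$z_{k+1}=\nu\sqrt q\,\Big(x_k-\frac1\mu\nabla f(x_k)\Big)+(1-\nu\sqrt q)z_k,$$ $$x_{k+1}=\frac{\tau\sqrt q}{1+\sqrt q}z_{k+1}+\Big(1-\frac{\tau\sqrt q}{1+\sqrt q}\Big)y_{k+1}.$$ Assumption A: there are non-negative functions $\tilde\eta,\tilde\nu,\tilde\tau$, analytic in a neighborhood of $0$, such that $\eta=\tilde\eta(\sqrt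 q)$, $\nu=\tilde\nu(\sqrt q)$, $\tau=\tilde\tau(\sqrt q)$; thus $\eta=\sum_{i\ge0}\eta_i(\sqrt q)^i$, $\nu=\sum_{i\ge0}\nu_i(\sqrt q)^i$, $\tau=\sum_{i\ge0}\tau_i(\sqrt q)^i$ are convergent expansions for $0\le q\le q_0$, for some constant $q_0>0$. *)

theory Defs
  imports "HOL-Analysis.Analysis"
begin

text \<open>
  The dimension of the ambient space has to be quantified inside formulas (the constants
  must not depend on it), so it cannot be a type parameter.  All spaces \<open>\<real>\<^sup>n\<close> are
  therefore realised inside one type: finitely supported real sequences with the Euclidean inner
  product, \<open>Rn n\<close> being the sequences that vanish from index \<open>n\<close> on.
\<close>

typedef fvec = "{x :: nat \<Rightarrow> real. finite {i. x i \<noteq> 0}}"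
  morphisms coord Abs_fvec
  by (rule exI[of _ "\<lambda>_. 0"]) simp

lemma finite_coord: "finite {i. coord x i \<noteq> 0}"
  using coord[of x] by simp

lemma coord_Abs_fvec: "finite {i. g i \<noteq> 0} \<Longrightarrow> coord (Abs_fvec g) = g"
  by (simp add: Abs_fvec_inverse)

lemma fvec_eq_iff: "x = y \<longleftrightarrow> (\<forall>i. coord x i = coord y i)"
  by (auto simp: coord_inject[symmetric])

instantiation fvec :: real_vector
begin

definition "0 = Abs_fvec (\<lambda>i. 0)"
definition "x + y = Abs_fvec (\<lambda>i. coord x i + coord y i)"
definition "x - y = Abs_fvec (\<lambda>i. coord x i - coord y i)"
definition "- x = Abs_fvec (\<lambda>i. - coord x i)"
definition "r *\<^sub>R x = Abs_fvec (\<lambda>i. r * coord x i)"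

lemma coord_zero [simp]: "coord 0 i = 0"
  by (simp add: zero_fvec_def coord_Abs_fvec)

lemma coord_add [simp]: "coord (x + y) i = coord x i + coord y i"
proof -
  have "finite {i. coord x i + coord y i \<noteq> 0}"
    by (rule finite_subset[OF _ finite_UnI[OF finite_coord[of x] finite_coord[of y]]]) auto
  then show ?thesis by (simp add: plus_fvec_def coord_Abs_fvec)
qed

lemma coord_diff [simp]: "coord (x - y) i = coord x i - coord y i"
proof -
  have "finite {i. coord x i - coord y i \<noteq> 0}"
    by (rule finite_subset[OF _ finite_UnI[OF finite_coord[of x] finite_coord[of y]]]) auto
  then show ?thesis by (simp add: minus_fvec_def coord_Abs_fvec)
qed

lemma coord_uminus [simp]: "coord (- x) i = - coord x i"
  using finite_coord[of x] by (simp add: uminus_fvec_def coord_Abs_fvec)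

lemma coord_scaleR [simp]: "coord (r *\<^sub>R x) i = r * coord x i"
proof -
  have "finite {i. r * coord x i \<noteq> 0}"
    by (rule finite_subset[OF _ finite_coord[of x]]) auto
  then show ?thesis by (simp add: scaleR_fvec_def coord_Abs_fvec)
qed

instance
  by standard (simp_all add: fvec_eq_iff algebra_simps)

end

instantiation fvec :: real_inner
begin

definition "inner x y = (\<Sum>i | coord x i * coord y i \<noteq> 0. coord x i * coord y i)"
definition "norm (x :: fvec) = sqrt (inner x x)"
definition "sgn (x :: fvec) = x /\<^sub>R norm x"
definition "dist (x :: fvec) y = norm (x - y)"
definition "uniformity = (INF e\<in>{0<..}. principal {(x :: fvec, y). dist x y < e})"
definition "open (U :: fvec set) \<longleftrightarrow>
  (\<forall>x\<in>U. eventually (\<lambda>(x', y). x' = x \<longrightarrow> y \<in> U) uniformity)"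

lemma inner_fvec_eq_sum:
  assumes "finite A" "{i. coord x i \<noteq> 0} \<subseteq> A \<or> {i. coord y i \<noteq> 0} \<subseteq> A"
  shows "inner x y = (\<Sum>i\<in>A. coord x i * coord y i)"
  unfolding inner_fvec_def
  by (rule sum.mono_neutral_left) (use assms in auto)

instance
proof
  fix x y z :: fvec and r :: real
  show "inner x y = inner y x"
    by (simp add: inner_fvec_def mult.commute)
  show "inner (x + y) z = inner x z + inner y z"
    by (simp add: inner_fvec_eq_sum[OF finite_coord[of z]] distrib_right sum.distrib)
  show "inner (r *\<^sub>R x) y = r * inner x y"
    by (simp add: inner_fvec_eq_sum[OF finite_coord[of y]] sum_distrib_left mult.assoc)
  show "0 \<le> inner x x"
    by (simp add: inner_fvec_def sum_nonneg)
  show "inner x x = 0 \<longleftrightarrow> x = 0"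
    by (auto simp: inner_fvec_eq_sum[OF finite_coord[of x]] sum_nonneg_eq_0_iff finite_coord
        fvec_eq_iff)
qed (simp_all add: norm_fvec_def sgn_fvec_def dist_fvec_def uniformity_fvec_def open_fvec_def)

end

definition Rn :: "nat \<Rightarrow> fvec set" where
  "Rn n = {x. \<forall>i\<ge>n. coord x i = 0}"

lemma inner_Rn:
  assumes "x \<in> Rn n"
  shows "inner x y = (\<Sum>i<n. coord x i * coord y i)"
  by (rule inner_fvec_eq_sum) (use assms in \<open>auto simp: Rn_def not_le[symmetric]\<close>)

definition grad :: "nat \<Rightarrow> (fvec \<Rightarrow> real) \<Rightarrow> fvec \<Rightarrow> fvec" where
  "grad n f x = (THE g. g \<in> Rn n \<and> (f has_derivative (\<lambda>h. inner g h)) (at x within Rn n))"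

lemma subspace_Rn: "subspace (Rn n)"
  by (auto simp: subspace_def Rn_def)

definition fbasis :: "nat \<Rightarrow> fvec" where
  "fbasis j = Abs_fvec (\<lambda>i. if i = j then 1 else 0)"

lemma coord_fbasis [simp]: "coord (fbasis j) i = (if i = j then 1 else 0)"
  by (simp add: fbasis_def coord_Abs_fvec)

lemma coord_sum: "coord (\<Sum>j\<in>A. g j) i = (\<Sum>j\<in>A. coord (g j) i)"
  by (induction A rule: infinite_finite_induct) auto

lemma Rn_expand:
  assumes "x \<in> Rn n"
  shows "x = (\<Sum>j<n. coord x j *\<^sub>R fbasis j)"
  using assms by (auto simp: fvec_eq_iff coord_sum Rn_def if_distrib sum.delta cong: if_cong)

lemma grad_unique:
  assumes "x \<in> Rn n" "g \<in> Rn n" "g' \<in> Rn n"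
    and "(f has_derivative (\<lambda>h. inner g h)) (at x within Rn n)"
    and "(f has_derivative (\<lambda>h. inner g' h)) (at x within Rn n)"
  shows "g = g'"
proof -
  define d where "d = g - g'"
  have line: "((\<lambda>t::real. x + t *\<^sub>R d) has_derivative (\<lambda>t. t *\<^sub>R d)) (at 0 within UNIV)"
    by (auto intro!: derivative_eq_intros)
  have d: "d \<in> Rn n"
    using subspace_diff[OF subspace_Rn] assms unfolding d_def by blast
  have sub: "(\<lambda>t::real. x + t *\<^sub>R d) ` UNIV \<subseteq> Rn n"
    using assms(1) d subspace_Rn[of n] by (auto simp: subspace_def)
  have *: "((\<lambda>t::real. f (x + t *\<^sub>R d)) has_derivative (\<lambda>t. inner u (t *\<^sub>R d))) (at 0)"
    if "(f has_derivative (\<lambda>h. inner u h)) (at x within Rn n)" for u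
  proof -
    have "(f has_derivative (\<lambda>h. inner u h)) (at (x + 0 *\<^sub>R d) within range (\<lambda>t::real. x + t *\<^sub>R d))"
      using has_derivative_subset[OF that sub] by simp
    from has_derivative_in_compose[OF line this] show ?thesis by simp
  qed
  have "(\<lambda>t::real. inner g (t *\<^sub>R d)) = (\<lambda>t. inner g' (t *\<^sub>R d))"
    using has_derivative_unique[OF *[OF assms(4)] *[OF assms(5)]] .
  then have "inner g d = inner g' d"
    by (metis scaleR_one)
  then have "inner d d = 0"
    by (simp add: d_def inner_diff_left inner_diff_right)
  then show ?thesis
    by (simp add: d_def)
qed

lemma grad_has_derivative:
  assumes "f differentiable_on Rn n" "x \<in> Rn n"
  shows "grad n f x \<in> Rn n \<and>
    (f has_derivative (\<lambda>h. inner (grad n f x) h)) (at x within Rn n)"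
proof -
  obtain D where D: "(f has_derivative D) (at x within Rn n)"
    using assms unfolding differentiable_on_def differentiable_def by blast
  define g where "g = (\<Sum>j<n. D (fbasis j) *\<^sub>R fbasis j)"
  have cg: "coord g i = (if i < n then D (fbasis i) else 0)" for i
    by (simp add: g_def coord_sum if_distrib cong: if_cong)
  then have g: "g \<in> Rn n"
    by (simp add: Rn_def)
  have lin: "linear D"
    using D has_derivative_linear by blast
  have eq: "D h = inner g h" if "h \<in> Rn n" for h
  proof -
    have "D h = D (\<Sum>j<n. coord h j *\<^sub>R fbasis j)"
      using Rn_expand[OF that] by simp
    also have "\<dots> = (\<Sum>j<n. coord h j * D (fbasis j))"
      by (simp add: linear_sum[OF lin] linear_scale[OF lin])
    also have "\<dots> = inner g h"
      unfolding inner_Rn[OF g] by (rule sum.cong) (auto simp: cg)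
    finally show ?thesis .
  qed
  have "(f has_derivative (\<lambda>h. inner g h)) (at x within Rn n)"
    unfolding has_derivative_within
  proof
    show "bounded_linear (\<lambda>h. inner g h)"
      by (rule bounded_linear_inner_right)
    have "((\<lambda>y. (1 / norm (y - x)) *\<^sub>R (f y - (f x + D (y - x)))) \<longlongrightarrow> 0) (at x within Rn n)"
      using D unfolding has_derivative_within by blast
    then show "((\<lambda>y. (1 / norm (y - x)) *\<^sub>R (f y - (f x + inner g (y - x)))) \<longlongrightarrow> 0)
        (at x within Rn n)"
    proof (rule Lim_transform_eventually)
      show "\<forall>\<^sub>F y in at x within Rn n. (1 / norm (y - x)) *\<^sub>R (f y - (f x + D (y - x))) =
          (1 / norm (y - x)) *\<^sub>R (f y - (f x + inner g (y - x)))"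
        using eq subspace_diff[OF subspace_Rn _ assms(2)]
        by (auto simp: eventually_at_filter)
    qed
  qed
  with g have "\<exists>!g. g \<in> Rn n \<and> (f has_derivative (\<lambda>h. inner g h)) (at x within Rn n)"
    using grad_unique[OF assms(2)] by blast
  then show ?thesis
    unfolding grad_def by (rule theI')
qed

text \<open>The class \<open>S\<^sup>1\<close> with parameters \<open>\<mu>\<close>, \<open>L\<close> on \<open>\<real>\<^sup>n\<close>; only the values of \<open>f\<close> on \<open>Rn n\<close> matter.\<close>

definition smooth_strongly_convex :: "nat \<Rightarrow> real \<Rightarrow> real \<Rightarrow> (fvec \<Rightarrow> real) set" where
  "smooth_strongly_convex n \<mu> L = {f.
     f differentiable_on Rn n \<and> continuous_on (Rn n) (grad n f) \<and>
     convex_on (Rn n) f \<and>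
     (\<forall>x\<in>Rn n. \<forall>y\<in>Rn n. norm (grad n f y - grad n f x) \<le> L * norm (y - x)) \<and>
     (\<forall>x\<in>Rn n. \<forall>y\<in>Rn n.
        f y \<ge> f x + inner (grad n f x) (y - x) + \<mu> / 2 * (norm (y - x))\<^sup>2)}"

text \<open>The value \<open>y 0\<close> is not used by the algorithm and is left unconstrained.\<close>

definition algorithm_A ::
  "(fvec \<Rightarrow> fvec) \<Rightarrow> real \<Rightarrow> real \<Rightarrow> real \<Rightarrow> real \<Rightarrow> real \<Rightarrow> fvec \<Rightarrow>
   (nat \<Rightarrow> fvec) \<Rightarrow> (nat \<Rightarrow> fvec) \<Rightarrow> (nat \<Rightarrow> fvec) \<Rightarrow> bool" where
  "algorithm_A G \<mu> s \<eta> \<nu> \<tau> x0 x y z \<longleftrightarrow>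
     (let q = \<mu> * s in
      x 0 = x0 \<and> z 0 = x0 \<and>
      (\<forall>k. y (Suc k) = x k - (\<eta> * s) *\<^sub>R G (x k) \<and>
           z (Suc k) = (\<nu> * sqrt q) *\<^sub>R (x k - (1 / \<mu>) *\<^sub>R G (x k)) + (1 - \<nu> * sqrt q) *\<^sub>R z k \<and>
           x (Suc k) = (\<tau> * sqrt q / (1 + sqrt q)) *\<^sub>R z (Suc k)
                     + (1 - \<tau> * sqrt q / (1 + sqrt q)) *\<^sub>R y (Suc k)))"

text \<open>
  The linear rate with constants \<open>C\<close>, \<open>C1\<close>, uniformly over all dimensions, all problem data
  and all stepsizes \<open>s \<le> smax \<mu> L\<close>.  The functions \<open>e\<close>, \<open>v\<close>, \<open>t\<close> give the parameters
  \<open>\<eta>\<close>, \<open>\<nu>\<close>, \<open>\<tau>\<close> in terms of \<open>sqrt q\<close>; \<open>xs\<close> is the minimizer.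
\<close>

definition linear_rate ::
  "(real \<Rightarrow> real) \<Rightarrow> (real \<Rightarrow> real) \<Rightarrow> (real \<Rightarrow> real) \<Rightarrow> (real \<Rightarrow> real \<Rightarrow> real) \<Rightarrow>
   real \<Rightarrow> real \<Rightarrow> bool" where
  "linear_rate e v t smax C C1 \<longleftrightarrow>
     (\<forall>n \<mu> L f xs x0 s x y z k.
        0 < \<mu> \<and> \<mu> \<le> L \<and> f \<in> smooth_strongly_convex n \<mu> L \<and>
        is_arg_min f (\<lambda>u. u \<in> Rn n) xs \<and> x0 \<in> Rn n \<and>
        0 < s \<and> s \<le> smax \<mu> L \<and>
        algorithm_A (grad n f) \<mu> s (e (sqrt (\<mu> * s))) (v (sqrt (\<mu> * s))) (t (sqrt (\<mu> * s)))
          x0 x y z \<and>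
        k \<ge> 1 \<longrightarrow>
        f (x k) - f xs \<le> C * L * (norm (x0 - xs))\<^sup>2 * (1 - C1 * sqrt (\<mu> * s)) ^ k)"

end

theory Submission
  imports Defs
begin

text \<open>
  One Lyapunov function serves all cases: with \<open>g\<^sub>k = \<nabla>f(x\<^sub>k)\<close>,
  \<open>E\<^sub>k = f(x\<^sub>k) - f\<^sup>* - (\<eta>s/2) |g\<^sub>k|\<^sup>2 + (\<mu>/2) |z\<^sub>k\<^sub>+\<^sub>1 - x\<^sup>*|\<^sup>2\<close>.
  Pairing \<open>x\<^sub>k\<close> with \<open>z\<^sub>k\<^sub>+\<^sub>1\<close> makes both increments involve the same gradient, and co-coercivity
  turns \<open>\<langle>g\<^sub>k, g\<^sub>k\<^sub>+\<^sub>1\<rangle>\<close> into a telescoping pair of squares.  With \<open>r = sqrt (\<mu>s)\<close>, the increment of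
  \<open>E\<close> is then at most \<open>-\<nu>r (f - f\<^sup>* + \<mu>/2 |z - x\<^sup>*|\<^sup>2 + \<mu>/2 |x - z|\<^sup>2)\<close> plus errors of order
  \<open>r\<^sup>2 \<langle>g, z - x\<rangle>\<close> (since \<open>\<nu>\<^sub>0 = \<tau>\<^sub>0\<close>) and \<open>(\<nu>\<^sup>2/2 - \<eta>) s |g|\<^sup>2\<close>, whose coefficient is at most
  \<open>O(r)\<close> (since \<open>\<eta>\<^sub>0 \<ge> \<tau>\<^sub>0\<^sup>2/2\<close>).  As \<open>s |g|\<^sup>2 \<le> 2 L s (f - f\<^sup>*)\<close>, both errors are absorbed as soon as
  \<open>L s\<close> is small.
\<close>

section \<open>Smoothness and convexity inequalities on \<open>Rn n\<close>\<close>

text \<open>\<open>h\<close> is \<open>f\<close> along the line through \<open>x\<close> and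
  \<open>y\<close> minus its quadratic upper model. By Cauchy-Schwarz and the Lipschitz bound its
  slope is nonpositive for \<open>t \<ge> 0\<close>, and comparing \<open>h 1\<close> with
  \<open>h 0\<close> gives the claim.\<close>

lemma descent_lemma:
  assumes f: "f \<in> smooth_strongly_convex n \<mu> L" and x: "x \<in> Rn n" and y: "y \<in> Rn n"
  shows "f y \<le> f x + inner (grad n f x) (y - x) + L / 2 * (norm (y - x))\<^sup>2"
proof -
  define d where "d = y - x"
  define h where "h t = f (x + t *\<^sub>R d) - t * inner (grad n f x) d - L / 2 * t\<^sup>2 * (norm d)\<^sup>2" for t
  have diff: "f differentiable_on Rn n"
    and lip: "\<And>u w. u \<in> Rn n \<Longrightarrow> w \<in> Rn n \<Longrightarrow> norm (grad n f w - grad n f u) \<le> L * norm (w - u)"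
    using f unfolding smooth_strongly_convex_def by auto
  have d: "d \<in> Rn n"
    using x y by (simp add: d_def subspace_diff[OF subspace_Rn])
  have mem: "x + t *\<^sub>R d \<in> Rn n" for t
    using x d subspace_Rn by (simp add: subspace_add subspace_scale)
  have der: "\<exists>D. (h has_real_derivative D) (at t) \<and> D \<le> 0" if "0 \<le> t" for t
  proof -
    let ?u = "x + t *\<^sub>R d"
    \<comment> \<open>The gradient represents a derivative within \<open>Rn n\<close> only. The line
      stays in \<open>Rn n\<close>, so restricting to its range lets the chain rule produce a full
      derivative in \<open>t\<close>.\<close>
    have "(f has_derivative (\<lambda>h. inner (grad n f ?u) h)) (at ?u within range (\<lambda>t. x + t *\<^sub>R d))"
      using grad_has_derivative[OF diff mem, of t] mem by (blast intro: has_derivative_subset)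
    moreover have "((\<lambda>t. x + t *\<^sub>R d) has_derivative (\<lambda>t. t *\<^sub>R d)) (at t within UNIV)"
      by (auto intro!: derivative_eq_intros)
    ultimately have "((\<lambda>t. f (x + t *\<^sub>R d)) has_derivative (\<lambda>k. inner (grad n f ?u) (k *\<^sub>R d))) (at t)"
      using has_derivative_in_compose by fast
    then have "((\<lambda>t. f (x + t *\<^sub>R d)) has_real_derivative inner (grad n f ?u) d) (at t)"
      by (simp add: has_field_derivative_def mult_commute_abs)
    then have "(h has_real_derivative
        inner (grad n f ?u) d - inner (grad n f x) d - L * t * (norm d)\<^sup>2) (at t)"
      unfolding h_def by (auto intro!: derivative_eq_intros simp: power2_eq_square)
    moreover have "inner (grad n f ?u) d - inner (grad n f x) d \<le> L * t * (norm d)\<^sup>2"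
    proof -
      have "inner (grad n f ?u) d - inner (grad n f x) d \<le> norm (grad n f ?u - grad n f x) * norm d"
        by (metis inner_diff_left norm_cauchy_schwarz)
      also have "\<dots> \<le> L * norm (t *\<^sub>R d) * norm d"
        using lip[OF x mem, of t] by (intro mult_right_mono) auto
      finally show ?thesis
        using that by (simp add: power2_eq_square mult.assoc)
    qed
    ultimately show ?thesis
      by (intro exI conjI) auto
  qed
  have "h 1 \<le> h 0"
    by (rule DERIV_nonpos_imp_nonincreasing[OF zero_le_one der])
  then show ?thesis
    by (simp add: h_def d_def)
qed

text \<open>The point \<open>w\<close> minimizes the descent-lemma bound at \<open>x\<close> for
  \<open>f\<close> tilted by the linear form of the gradient at \<open>y\<close>. Bounding
  \<open>f w\<close> from above by that lemma and from below by convexity at \<open>y\<close> leaves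
  the squared gradient difference as the gain.\<close>

lemma grad_cocoercive:
  assumes f: "f \<in> smooth_strongly_convex n \<mu> L" and "0 \<le> \<mu>" "0 < L"
    and x: "x \<in> Rn n" and y: "y \<in> Rn n"
  shows "f y - f x \<le> inner (grad n f y) (y - x) - (norm (grad n f y - grad n f x))\<^sup>2 / (2 * L)"
proof -
  define p where "p = grad n f x - grad n f y"
  define w where "w = x - (1 / L) *\<^sub>R p"
  have "f differentiable_on Rn n"
    using f unfolding smooth_strongly_convex_def by auto
  then have "p \<in> Rn n"
    unfolding p_def using x y grad_has_derivative subspace_Rn by (blast intro: subspace_diff)
  then have w: "w \<in> Rn n"
    unfolding w_def using x subspace_Rn by (blast intro: subspace_diff subspace_scale)
  have "f y + inner (grad n f y) (w - y) + \<mu> / 2 * (norm (w - y))\<^sup>2 \<le> f w"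
    using f w y unfolding smooth_strongly_convex_def by auto
  moreover have "0 \<le> \<mu> / 2 * (norm (w - y))\<^sup>2"
    using \<open>0 \<le> \<mu>\<close> by simp
  moreover have "f w \<le> f x + inner (grad n f x) (w - x) + L / 2 * (norm (w - x))\<^sup>2"
    by (rule descent_lemma[OF f x w])
  moreover have "inner (grad n f x) (w - x) - inner (grad n f y) (w - y)
      = inner (grad n f y) (y - x) - inner p p / L"
    by (simp add: w_def p_def inner_simps inner_commute add_divide_distrib diff_divide_distrib)
  moreover have "L / 2 * (norm (w - x))\<^sup>2 = inner p p / (2 * L)"
    using \<open>0 < L\<close> by (simp add: w_def dot_square_norm power2_eq_square field_simps)
  moreover have "(norm (grad n f y - grad n f x))\<^sup>2 / (2 * L) = inner p p / (2 * L)"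
    unfolding p_def by (subst norm_minus_commute) (simp add: power2_norm_eq_inner)
  moreover have "inner p p / L = inner p p / (2 * L) + inner p p / (2 * L)"
    by simp
  ultimately show ?thesis
    by linarith
qed

text \<open>A gradient step of length \<open>1 / L\<close> lowers \<open>f\<close> by at least
  \<open>(norm g)^2 / (2 * L)\<close>, yet cannot go below the minimum. Taking \<open>x = xs\<close>
  also shows that the gradient vanishes at the minimizer.\<close>

lemma grad_norm_le_gap:
  assumes f: "f \<in> smooth_strongly_convex n \<mu> L" and "0 < L"
    and min: "is_arg_min f (\<lambda>u. u \<in> Rn n) xs" and x: "x \<in> Rn n"
  shows "(norm (grad n f x))\<^sup>2 \<le> 2 * L * (f x - f xs)"
proof -
  define g where "g = grad n f x"
  define w where "w = x - (1 / L) *\<^sub>R g"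
  have "f differentiable_on Rn n"
    using f unfolding smooth_strongly_convex_def by auto
  then have w: "w \<in> Rn n"
    unfolding w_def g_def using x grad_has_derivative subspace_Rn
    by (blast intro: subspace_diff subspace_scale)
  then have "f xs \<le> f w"
    using min by (auto simp: is_arg_min_def not_less)
  also have "f w \<le> f x + inner g (w - x) + L / 2 * (norm (w - x))\<^sup>2"
    unfolding g_def by (rule descent_lemma[OF f x w])
  also have "inner g (w - x) = - inner g g / L"
    by (simp add: w_def inner_simps)
  also have "L / 2 * (norm (w - x))\<^sup>2 = inner g g / (2 * L)"
    using \<open>0 < L\<close> by (simp add: w_def dot_square_norm power2_eq_square field_simps)
  finally show ?thesis
    using \<open>0 < L\<close> by (simp add: g_def[symmetric] power2_norm_eq_inner field_simps)
qed

section \<open>One step of the Lyapunov function\<close>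

text \<open>Abstract form of the step from k to k+1: \<open>X\<close>, \<open>Z\<close>,
  \<open>Z'\<close> stand for x_{k+1}, z_{k+1}, z_{k+2} relative to the minimizer, \<open>g\<close>,
  \<open>g0\<close> for the new and old gradients, \<open>F\<close>, \<open>F0\<close> for the gaps.
  The weight \<open>\<rho>\<close> comes from writing x_{k+1} - x_k through z_{k+1} - x_{k+1}. The
  estimate is the sum of an expansion of \<open>norm Z'\<close> squared, co-coercivity, and strong
  convexity weighted by \<open>\<nu> * r\<close>.\<close>

lemma lyapunov_increment:
  fixes X Z g g0 :: "'a::real_inner"
  assumes pos: "0 < \<mu>" "0 < L" "0 \<le> \<eta>" "0 \<le> \<nu>" "0 \<le> s" "0 \<le> r"
    and r: "r\<^sup>2 = \<mu> * s" and \<eta>: "\<eta> * s * L \<le> 1"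
    and coc: "F - F0 \<le> \<rho> * inner g (Z - X) - \<eta> * s * inner g g0 - (norm (g - g0))\<^sup>2 / (2 * L)"
    and sc: "F + \<mu> / 2 * (norm X)\<^sup>2 \<le> inner g X"
    and Z': "Z' = Z + (\<nu> * r) *\<^sub>R (X - Z) - (\<nu> * r / \<mu>) *\<^sub>R g"
  shows "(F - \<eta> * s / 2 * (norm g)\<^sup>2 + \<mu> / 2 * (norm Z')\<^sup>2)
       - (F0 - \<eta> * s / 2 * (norm g0)\<^sup>2 + \<mu> / 2 * (norm Z)\<^sup>2)
    \<le> - (\<nu> * r) * (F + \<mu> / 2 * (norm Z)\<^sup>2 + \<mu> / 2 * (norm (X - Z))\<^sup>2)
      + (\<rho> - \<nu> * r + \<nu>\<^sup>2 * r\<^sup>2) * inner g (Z - X)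
      + \<nu>\<^sup>2 / 2 * \<mu> * r\<^sup>2 * (norm (X - Z))\<^sup>2 + (\<nu>\<^sup>2 / 2 - \<eta>) * s * (norm g)\<^sup>2"
proof -
  define W where "W = X - Z"
  define P where "P = inner W W"
  have a: "inner Z' Z' = inner Z Z + 2 * (\<nu> * r) * inner Z W - 2 * (\<nu> * r / \<mu>) * inner Z g
      + (\<nu> * r)\<^sup>2 * P - 2 * (\<nu> * r) * (\<nu> * r / \<mu>) * inner W g
      + (\<nu> * r / \<mu>)\<^sup>2 * inner g g"
    unfolding Z' W_def[symmetric] P_def
    by (simp add: inner_simps inner_commute power2_eq_square algebra_simps)
  have rr: "r * r = \<mu> * s"
    using r by (simp add: power2_eq_square)
  have "\<mu> / 2 * ((\<nu> * r / \<mu>)\<^sup>2 * inner g g) = \<nu>\<^sup>2 * (r * r) / (2 * \<mu>) * inner g g"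
    using pos by (simp add: power2_eq_square field_simps)
  also have "\<dots> = \<nu>\<^sup>2 / 2 * s * inner g g"
    using pos unfolding rr by simp
  finally have b: "\<mu> / 2 * ((\<nu> * r / \<mu>)\<^sup>2 * inner g g) = \<nu>\<^sup>2 / 2 * s * inner g g" .
  have "\<mu> / 2 * inner Z' Z' = \<mu> / 2 * inner Z Z + \<mu> * \<nu> * r * inner Z W - \<nu> * r * inner Z g
      + \<mu> / 2 * (\<nu> * r)\<^sup>2 * P - \<nu>\<^sup>2 * r\<^sup>2 * inner W g + \<mu> / 2 * ((\<nu> * r / \<mu>)\<^sup>2 * inner g g)"
    unfolding a using pos by (simp add: field_simps power2_eq_square)
  then have Zinc: "\<mu> / 2 * inner Z' Z' = \<mu> / 2 * inner Z Z + \<mu> * \<nu> * r * inner Z W - \<nu> * r * inner Z g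
      + \<mu> / 2 * (\<nu> * r)\<^sup>2 * P - \<nu>\<^sup>2 * r\<^sup>2 * inner W g + \<nu>\<^sup>2 / 2 * s * inner g g"
    unfolding b .
  \<comment> \<open>Lowering the co-coercivity weight to \<open>\<eta> * s / 2\<close> makes the
    mixed product of \<open>g\<close> and \<open>g0\<close> cancel. With the gradient corrections in
    the energies, the \<open>g0\<close> squares then cancel too and
    \<open>- \<eta> * s * inner g g\<close> remains.\<close>
  have "\<eta> * s / 2 \<le> 1 / (2 * L)"
    using \<eta> pos by (simp add: field_simps)
  then have "\<eta> * s / 2 * (norm (g - g0))\<^sup>2 \<le> 1 / (2 * L) * (norm (g - g0))\<^sup>2"
    by (rule mult_right_mono) simp
  moreover have "(norm (g - g0))\<^sup>2 = inner g g - 2 * inner g g0 + inner g0 g0"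
    by (simp add: power2_norm_eq_inner inner_simps inner_commute)
  ultimately have "\<eta> * s / 2 * (inner g g - 2 * inner g g0 + inner g0 g0) \<le> (norm (g - g0))\<^sup>2 / (2 * L)"
    by simp
  then have Finc: "F - F0 \<le> - \<rho> * inner W g - \<eta> * s / 2 * inner g g - \<eta> * s / 2 * inner g0 g0"
    using coc by (simp add: W_def inner_simps inner_commute algebra_simps)
  \<comment> \<open>Splitting \<open>X = Z + W\<close> turns the term
    \<open>- \<nu> * r * inner Z g\<close> of \<open>Zinc\<close> into one controlled by strong
    convexity. The product \<open>inner Z W\<close> cancels against the one in
    \<open>Zinc\<close>.\<close>
  have "inner X g = inner Z g + inner W g"
    by (simp add: W_def inner_simps)
  moreover have "\<nu> * r * (F + \<mu> / 2 * inner X X) \<le> \<nu> * r * inner X g"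
    using sc pos by (intro mult_left_mono) (auto simp: power2_norm_eq_inner inner_commute)
  moreover have "inner X X = inner Z Z + 2 * inner Z W + P"
    by (simp add: W_def P_def inner_simps inner_commute)
  ultimately have S: "\<nu> * r * (F + \<mu> / 2 * (inner Z Z + 2 * inner Z W + P))
      \<le> \<nu> * r * (inner Z g + inner W g)"
    by simp
  have gW: "inner g (Z - X) = - inner W g"
    by (simp add: W_def inner_simps inner_commute)
  show ?thesis
    using Zinc Finc S
    unfolding gW W_def[symmetric] power2_norm_eq_inner P_def[symmetric]
    by (simp add: algebra_simps power2_eq_square)
qed

lemma norm_diff_square_le:
  fixes a b :: "'a::real_inner"
  shows "(norm (a - b))\<^sup>2 \<le> 2 * ((norm a)\<^sup>2 + (norm b)\<^sup>2)"
proof -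
  have "0 \<le> inner (a + b) (a + b)"
    by simp
  then show ?thesis
    by (simp add: power2_norm_eq_inner inner_simps inner_commute)
qed

lemma norm_add3_square_le:
  fixes a b c :: "'a::real_inner"
  shows "(norm (a + b + c))\<^sup>2 \<le> 3 * ((norm a)\<^sup>2 + (norm b)\<^sup>2 + (norm c)\<^sup>2)"
proof -
  have "0 \<le> inner (a - b) (a - b) + inner (b - c) (b - c) + inner (a - c) (a - c)"
    by simp
  then show ?thesis
    by (simp add: power2_norm_eq_inner inner_simps inner_commute)
qed

text \<open>Here \<open>N\<close> is the limit value of \<nu> at 0 and \<open>K\<close> bounds the
  error coefficients. All errors are absorbed by part of the decrease, and what is left is compared
  with the new energy.\<close>

lemma lyapunov_contraction:
  fixes X Z g g0 :: "'a::real_inner"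
  assumes pos: "0 < \<mu>" "0 < L" "0 \<le> \<eta>" "0 < N" "0 \<le> s" "0 < r" "0 \<le> K"
    and r: "r\<^sup>2 = \<mu> * s" and \<eta>: "\<eta> * s * L \<le> 1 / 2"
    and \<nu>: "N / 2 \<le> \<nu>" "\<nu> \<le> 2 * N"
    and coc: "F - F0 \<le> \<rho> * inner g (Z - X) - \<eta> * s * inner g g0 - (norm (g - g0))\<^sup>2 / (2 * L)"
    and sc: "F + \<mu> / 2 * (norm X)\<^sup>2 \<le> inner g X"
    and qg: "\<mu> / 2 * (norm X)\<^sup>2 \<le> F"
    and gF: "(norm g)\<^sup>2 \<le> 2 * L * F" and gF0: "(norm g0)\<^sup>2 \<le> 2 * L * F0"
    and Z': "Z' = Z + (\<nu> * r) *\<^sub>R (X - Z) - (\<nu> * r / \<mu>) *\<^sub>R g"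
    and err: "\<bar>\<rho> - \<nu> * r + \<nu>\<^sup>2 * r\<^sup>2\<bar> \<le> K * r\<^sup>2" "\<nu>\<^sup>2 / 2 - \<eta> \<le> K * r"
    and Nr: "16 * N * r \<le> 1"
    and Ls: "8 * (2 * K\<^sup>2 / N + K) * (L * s) \<le> N" "4 * N\<^sup>2 * (L * s) \<le> 1"
  shows "F - \<eta> * s / 2 * (norm g)\<^sup>2 + \<mu> / 2 * (norm Z')\<^sup>2
    \<le> (1 - N / 56 * r) * (F0 - \<eta> * s / 2 * (norm g0)\<^sup>2 + \<mu> / 2 * (norm Z)\<^sup>2)"
    (is "?E \<le> _ * ?D")
proof -
  define W where "W = (norm (X - Z))\<^sup>2"
  define Q where "Q = s * (norm g)\<^sup>2"
  define B where "B = F + \<mu> / 2 * (norm Z)\<^sup>2"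
  have F: "0 \<le> F"
    using qg pos by (meson half_gt_zero less_imp_le mult_nonneg_nonneg order_trans zero_le_power2)
  have W: "0 \<le> W" and Q: "0 \<le> Q"
    using pos by (auto simp: W_def Q_def)
  have QF: "Q \<le> 2 * (L * s) * F"
    using mult_left_mono[OF gF \<open>0 \<le> s\<close>] by (simp add: Q_def algebra_simps)
  have step: "?E - ?D \<le> - (\<nu> * r) * (B + \<mu> / 2 * W)
      + (\<rho> - \<nu> * r + \<nu>\<^sup>2 * r\<^sup>2) * inner g (Z - X)
      + \<nu>\<^sup>2 / 2 * \<mu> * r\<^sup>2 * W + (\<nu>\<^sup>2 / 2 - \<eta>) * Q"
    using lyapunov_increment[OF pos(1,2,3) _ pos(5) _ r _ coc sc Z'] pos \<nu> \<eta>
    by (simp add: W_def Q_def B_def mult.assoc)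
  have cross: "(\<rho> - \<nu> * r + \<nu>\<^sup>2 * r\<^sup>2) * inner g (Z - X) \<le> r * (2 * K\<^sup>2 / N * Q + N / 8 * (\<mu> * W))"
  proof -
    \<comment> \<open>With \<open>r = sqrt \<mu> * sqrt s\<close>, one factor \<open>r\<close> is
      kept outside and the other is shared between the gradient and \<open>X - Z\<close>, giving the
      scaled quantities in \<open>Q\<close> and \<open>\<mu> * W\<close>.\<close>
    define a where "a = sqrt s * norm g"
    define b where "b = sqrt \<mu> * norm (X - Z)"
    have rs: "r = sqrt \<mu> * sqrt s"
      using r pos by (metis less_imp_le real_sqrt_mult real_sqrt_unique)
    have "(\<rho> - \<nu> * r + \<nu>\<^sup>2 * r\<^sup>2) * inner g (Z - X)
        \<le> \<bar>\<rho> - \<nu> * r + \<nu>\<^sup>2 * r\<^sup>2\<bar> * \<bar>inner g (Z - X)\<bar>"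
      by (metis abs_ge_self abs_mult)
    also have "\<dots> \<le> K * r\<^sup>2 * (norm g * norm (X - Z))"
      using err Cauchy_Schwarz_ineq2[of g "Z - X"] pos
      by (intro mult_mono) (auto simp: norm_minus_commute)
    also have "\<dots> = r * (K * (a * b))"
      by (simp add: power2_eq_square rs a_def b_def)
    also have "\<dots> \<le> r * (2 * K\<^sup>2 / N * a\<^sup>2 + N / 8 * b\<^sup>2)"
    proof (rule mult_left_mono)
      \<comment> \<open>Young's inequality, weighted so that the \<open>W\<close> part costs exactly
        \<open>N / 8\<close>.\<close>
      have "0 \<le> (4 * K * a - N * b)\<^sup>2 / (8 * N)"
        using pos by simp
      also have "\<dots> = 2 * K\<^sup>2 / N * a\<^sup>2 + N / 8 * b\<^sup>2 - K * (a * b)"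
        using pos by (simp add: field_simps power2_eq_square)
      finally show "K * (a * b) \<le> 2 * K\<^sup>2 / N * a\<^sup>2 + N / 8 * b\<^sup>2"
        by simp
    qed (use pos in simp)
    also have "a\<^sup>2 = Q"
      using pos by (simp add: a_def Q_def power_mult_distrib)
    also have "b\<^sup>2 = \<mu> * W"
      using pos by (simp add: b_def W_def power_mult_distrib)
    finally show ?thesis .
  qed
  have eta: "(\<nu>\<^sup>2 / 2 - \<eta>) * Q \<le> r * (K * Q)"
    using mult_right_mono[OF err(2) Q] by (simp add: algebra_simps)
  \<comment> \<open>\<open>Q\<close> is at most \<open>2 * (L * s) * F\<close>, so a small
    \<open>L * s\<close> makes both gradient errors a fraction of the gap.\<close>
  have QB: "2 * K\<^sup>2 / N * Q + K * Q \<le> N / 4 * F"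
  proof -
    have "(2 * K\<^sup>2 / N + K) * Q \<le> (2 * K\<^sup>2 / N + K) * (2 * (L * s) * F)"
      using pos QF by (intro mult_left_mono) auto
    also have "\<dots> = 8 * (2 * K\<^sup>2 / N + K) * (L * s) * (F / 4)"
      by simp
    also have "\<dots> \<le> N * (F / 4)"
      using Ls F by (intro mult_right_mono) auto
    finally show ?thesis
      by (simp add: algebra_simps)
  qed
  have quad: "\<nu>\<^sup>2 / 2 * \<mu> * r\<^sup>2 * W \<le> r * (N / 8 * (\<mu> * W))"
  proof -
    have "\<nu>\<^sup>2 * r \<le> (2 * N)\<^sup>2 * r"
      using \<nu> pos by (intro mult_right_mono power_mono) auto
    also have "\<dots> = N / 4 * (16 * N * r)"
      by (simp add: power2_eq_square)
    also have "\<dots> \<le> N / 4 * 1"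
      using Nr pos by (intro mult_left_mono) auto
    finally have "\<nu>\<^sup>2 * r / 2 \<le> N / 8"
      by linarith
    then have "r * (\<nu>\<^sup>2 * r / 2 * (\<mu> * W)) \<le> r * (N / 8 * (\<mu> * W))"
      using pos W by (intro mult_left_mono mult_right_mono) auto
    then show ?thesis
      by (simp add: power2_eq_square algebra_simps)
  qed
  have B: "F \<le> B" "0 \<le> B"
    using F pos by (auto simp: B_def)
  \<comment> \<open>Budget: half of \<open>N\<close> is guaranteed as decrease rate. Its
    \<open>W\<close> share, \<open>N / 4\<close>, is used up by \<open>cross\<close> and
    \<open>quad\<close>, each taking \<open>N / 8\<close>; the gradient errors take
    \<open>N / 4\<close> of the \<open>B\<close> share, leaving \<open>N / 4\<close>.\<close>
  have dec: "?E - ?D \<le> - (N / 4 * r) * B"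
  proof -
    have "- (\<nu> * r) * (B + \<mu> / 2 * W) \<le> - (N / 2 * r) * (B + \<mu> / 2 * W)"
      using \<nu> pos W B by (intro mult_right_mono) auto
    then have "?E - ?D \<le> - (N / 2 * r) * (B + \<mu> / 2 * W) + r * (2 * K\<^sup>2 / N * Q + N / 8 * (\<mu> * W))
        + r * (N / 8 * (\<mu> * W)) + r * (K * Q)"
      using step cross eta quad by linarith
    also have "\<dots> = r * (2 * K\<^sup>2 / N * Q + K * Q - N / 2 * B)"
      by (simp add: algebra_simps)
    also have "\<dots> \<le> r * (- (N / 4) * B)"
    proof (rule mult_left_mono)
      have "N / 4 * F \<le> N / 4 * B"
        using B pos by (intro mult_left_mono) auto
      then show "2 * K\<^sup>2 / N * Q + K * Q - N / 2 * B \<le> - (N / 4) * B"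
        using QB by (simp add: algebra_simps)
    qed (use pos in simp)
    finally show ?thesis
      by (simp add: algebra_simps)
  qed
  \<comment> \<open>7 = 1 + 6: one \<open>B\<close> bounds \<open>F\<close>. The three terms of
    \<open>Z'\<close> contribute, with factor 3, \<open>\<mu> / 2\<close> times the squares of
    \<open>Z\<close>, \<open>X\<close> and again \<open>Z\<close>, plus \<open>F\<close>; by
    \<open>qg\<close> this is at most \<open>6 * B\<close>.\<close>
  have EB: "?E \<le> 7 * B"
  proof -
    have "(norm Z')\<^sup>2 \<le> 3 * ((norm Z)\<^sup>2 + (norm ((\<nu> * r) *\<^sub>R (X - Z)))\<^sup>2 + (norm (- ((\<nu> * r / \<mu>) *\<^sub>R g)))\<^sup>2)"
      using norm_add3_square_le[of Z "(\<nu> * r) *\<^sub>R (X - Z)" "- ((\<nu> * r / \<mu>) *\<^sub>R g)"]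
      by (simp add: Z')
    also have "(norm ((\<nu> * r) *\<^sub>R (X - Z)))\<^sup>2 = (\<nu> * r)\<^sup>2 * W"
      by (simp add: W_def power_mult_distrib)
    also have "(norm (- ((\<nu> * r / \<mu>) *\<^sub>R g)))\<^sup>2 = (\<nu> * r / \<mu>)\<^sup>2 * (norm g)\<^sup>2"
      by (simp add: power_mult_distrib power_divide)
    also have "\<dots> = \<nu>\<^sup>2 * Q / \<mu>"
      unfolding power_divide power_mult_distrib r Q_def using pos by (simp add: power2_eq_square)
    finally have "\<mu> / 2 * (norm Z')\<^sup>2 \<le> \<mu> / 2 * (3 * ((norm Z)\<^sup>2 + (\<nu> * r)\<^sup>2 * W + \<nu>\<^sup>2 * Q / \<mu>))"
      using pos by (intro mult_left_mono) auto
    also have "\<dots> = 3 * (\<mu> / 2 * (norm Z)\<^sup>2 + \<mu> / 2 * ((\<nu> * r)\<^sup>2 * W) + \<nu>\<^sup>2 * Q / 2)"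
      using pos by (simp add: field_simps)
    also have "\<mu> / 2 * ((\<nu> * r)\<^sup>2 * W) \<le> \<mu> / 2 * ((norm X)\<^sup>2 + (norm Z)\<^sup>2)"
    proof (rule mult_left_mono)
      have "\<nu> * r \<le> 2 * N * r"
        using \<nu> pos by (intro mult_right_mono) auto
      then have "\<nu> * r \<le> 1 / 2"
        using Nr by simp
      then have "(\<nu> * r)\<^sup>2 \<le> (1 / 2)\<^sup>2"
        using \<nu> pos by (intro power_mono) auto
      then have "(\<nu> * r)\<^sup>2 * W \<le> 1 / 2 * W"
        using W by (intro mult_right_mono) (auto simp: power2_eq_square)
      moreover have "W \<le> 2 * ((norm X)\<^sup>2 + (norm Z)\<^sup>2)"
        unfolding W_def by (rule norm_diff_square_le)
      ultimately show "(\<nu> * r)\<^sup>2 * W \<le> (norm X)\<^sup>2 + (norm Z)\<^sup>2"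
        by simp
    qed (use pos in simp)
    also have "\<nu>\<^sup>2 * Q / 2 \<le> F"
    proof -
      have "\<nu>\<^sup>2 * Q \<le> (2 * N)\<^sup>2 * (2 * (L * s) * F)"
        using \<nu> pos QF Q by (intro mult_mono power_mono) auto
      also have "\<dots> = 4 * N\<^sup>2 * (L * s) * (2 * F)"
        by (simp add: power2_eq_square)
      also have "\<dots> \<le> 1 * (2 * F)"
        using Ls F by (intro mult_right_mono) auto
      finally show ?thesis by simp
    qed
    finally have "\<mu> / 2 * (norm Z')\<^sup>2 \<le> 6 * B"
      using qg by (simp add: B_def algebra_simps)
    moreover have "0 \<le> \<eta> * s / 2 * (norm g)\<^sup>2"
      using pos by simp
    ultimately show ?thesis
      using B by linarith
  qed
  \<comment> \<open>As \<open>\<eta> * s * L \<le> 1 / 2\<close>, the gradient correction takes away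
    at most half of \<open>F0\<close>. Nonnegativity is what allows the factor in front of
    \<open>?D\<close> to be enlarged below.\<close>
  have E0: "0 \<le> ?D"
  proof -
    have F0: "0 \<le> F0"
      using gF0 pos by (metis mult_pos_pos order_trans zero_le_mult_iff zero_le_power2 zero_less_numeral not_le)
    have "\<eta> * s / 2 * (norm g0)\<^sup>2 \<le> \<eta> * s / 2 * (2 * L * F0)"
      using gF0 pos by (intro mult_left_mono) auto
    also have "\<dots> = \<eta> * s * L * F0"
      by simp
    also have "\<dots> \<le> 1 / 2 * F0"
      using \<eta> F0 by (intro mult_right_mono) auto
    finally show ?thesis
      using F0 pos by (simp add: add_nonneg_nonneg)
  qed
  \<comment> \<open>\<open>N / 28\<close> is the remaining rate \<open>N / 4\<close> divided by the
    7 of \<open>EB\<close>. Passing from \<open>1 / (1 + a)\<close> to \<open>1 - a / 2\<close>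
    costs a further factor 2, hence 56.\<close>
  define a where "a = N / 28 * r"
  have a: "0 \<le> a" "a \<le> 1"
    using pos Nr by (auto simp: a_def)
  have "a * ?E \<le> N / 4 * r * B"
    using mult_left_mono[OF EB a(1)] by (simp add: a_def algebra_simps)
  moreover have "(1 + a) * E \<le> D" if "a * E \<le> c" "E - D \<le> - c" for E D c :: real
    using that by (simp add: algebra_simps)
  ultimately have "(1 + a) * ?E \<le> ?D"
    using dec by (metis mult_minus_left)
  also have "\<dots> \<le> (1 + a) * (1 - a / 2) * ?D"
  proof -
    have "a * a \<le> a * 1"
      using a by (intro mult_left_mono) auto
    then have "1 \<le> (1 + a) * (1 - a / 2)"
      by (simp add: algebra_simps)
    then show ?thesis
      using mult_right_mono[OF _ E0] by fastforce
  qed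
  finally have "?E \<le> (1 - a / 2) * ?D"
    using a by (simp add: mult.assoc)
  then show ?thesis
    by (simp add: a_def)
qed

section \<open>Parameters for small \<open>r\<close>\<close>

lemma has_fps_expansion_imp_differentiable:
  fixes F :: "real fps"
  assumes "f has_fps_expansion F"
  shows "f differentiable (at 0)"
proof -
  have "0 < fps_conv_radius F" and ev: "\<forall>\<^sub>F z in nhds 0. eval_fps F z = f z"
    using assms by (auto simp: has_fps_expansion_def)
  then have "(eval_fps F has_field_derivative eval_fps (fps_deriv F) 0) (at 0)"
    by (intro has_field_derivative_eval_fps) (auto simp: zero_ereal_def[symmetric])
  then have "(f has_field_derivative eval_fps (fps_deriv F) 0) (at 0)"
    using DERIV_cong_ev[OF refl ev refl] by blast
  then show ?thesis
    by (auto simp: real_differentiable_def)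
qed

lemma has_fps_expansion_imp_value_0:
  fixes F :: "real fps"
  assumes "f has_fps_expansion F"
  shows "f 0 = fps_nth F 0"
proof -
  have "\<forall>\<^sub>F z in nhds 0. eval_fps F z = f z"
    using assms by (simp add: has_fps_expansion_def)
  then have "eval_fps F 0 = f 0"
    by (rule eventually_nhds_x_imp_x)
  then show ?thesis
    by (simp add: eval_fps_at_0)
qed

lemma differentiable_linear_bound:
  fixes g :: "real \<Rightarrow> real"
  assumes "g differentiable (at 0)"
  obtains K where "0 \<le> K" "\<forall>\<^sub>F r in at_right 0. \<bar>g r - g 0\<bar> \<le> K * r"
proof -
  obtain D where "(g has_real_derivative D) (at 0)"
    using assms by (auto simp: real_differentiable_def)
  then have "((\<lambda>h. \<bar>(g h - g 0) / h\<bar>) \<longlongrightarrow> \<bar>D\<bar>) (at 0)"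
    using tendsto_rabs by (force simp: DERIV_def)
  then have "\<forall>\<^sub>F h in at 0. \<bar>(g h - g 0) / h\<bar> < \<bar>D\<bar> + 1"
    by (rule order_tendstoD) simp
  then have "\<forall>\<^sub>F h in at_right 0. \<bar>(g h - g 0) / h\<bar> < \<bar>D\<bar> + 1"
    by (rule filter_leD[OF at_le, rotated]) simp
  then have "\<forall>\<^sub>F h in at_right 0. \<bar>g h - g 0\<bar> \<le> (\<bar>D\<bar> + 1) * h"
    using eventually_at_right_less[of 0]
  proof eventually_elim
    case (elim h)
    then show ?case
      by (simp add: abs_divide field_simps)
  qed
  then show ?thesis
    using that[of "\<bar>D\<bar> + 1"] by simp
qed

text \<open>\<open>\<phi>\<close> is the cross-term coefficient divided by \<open>r\<close> and
  \<open>\<psi>\<close> the coefficient of the gradient square. Both have linear error bounds at 0,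
  while the remaining inequalities follow by continuity.\<close>

lemma parameter_error_bounds:
  fixes e v t :: "real \<Rightarrow> real"
  assumes diff: "e differentiable (at 0)" "v differentiable (at 0)" "t differentiable (at 0)"
    and v0: "0 < v 0" "v 0 = t 0" and e0: "(v 0)\<^sup>2 / 2 \<le> e 0"
  obtains K \<delta> where "0 \<le> K" "0 < \<delta>"
    "\<And>r. 0 < r \<Longrightarrow> r < \<delta> \<Longrightarrow> v 0 / 2 \<le> v r \<and> v r \<le> 2 * v 0 \<and> 0 \<le> e r \<and> e r \<le> e 0 + 1 \<and>
      0 < 1 + r - t r * r \<and>
      \<bar>t r * r / (1 + r - t r * r) - v r * r + (v r)\<^sup>2 * r\<^sup>2\<bar> \<le> K * r\<^sup>2 \<and>
      (v r)\<^sup>2 / 2 - e r \<le> K * r \<and> 16 * v 0 * r \<le> 1"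
proof -
  define \<phi> where "\<phi> r = t r / (1 + r - t r * r) - v r + (v r)\<^sup>2 * r" for r
  define \<psi> where "\<psi> r = (v r)\<^sup>2 / 2 - e r" for r
  obtain De Dv Dt where D: "(e has_real_derivative De) (at 0)" "(v has_real_derivative Dv) (at 0)"
    "(t has_real_derivative Dt) (at 0)"
    using diff unfolding real_differentiable_def by blast
  have "\<exists>D. (\<phi> has_real_derivative D) (at 0)"
    unfolding \<phi>_def by (rule exI) (rule derivative_eq_intros refl D | simp)+
  moreover have "\<exists>D. (\<psi> has_real_derivative D) (at 0)"
    unfolding \<psi>_def by (rule exI) (rule derivative_eq_intros refl D | simp)+
  ultimately have dd: "\<phi> differentiable (at 0)" "\<psi> differentiable (at 0)"
    unfolding real_differentiable_def by blast+
  obtain K1 where K1: "0 \<le> K1" and \<phi>: "\<forall>\<^sub>F r in at_right 0. \<bar>\<phi> r - \<phi> 0\<bar> \<le> K1 * r"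
    by (rule differentiable_linear_bound[OF dd(1)])
  obtain K2 where \<psi>: "\<forall>\<^sub>F r in at_right 0. \<bar>\<psi> r - \<psi> 0\<bar> \<le> K2 * r"
    by (rule differentiable_linear_bound[OF dd(2)])
  have lim: "(g \<longlongrightarrow> g 0) (at_right 0)" if "g differentiable (at 0)" for g :: "real \<Rightarrow> real"
    using differentiable_imp_continuous_within[OF that]
    by (simp add: continuous_within tendsto_within_subset[of _ _ _ UNIV])
  have "0 < e 0"
    using e0 v0 by (meson half_gt_zero less_le_trans zero_less_power)
  have "\<forall>\<^sub>F r in at_right 0. v 0 / 2 < v r" "\<forall>\<^sub>F r in at_right 0. v r < 2 * v 0"
    using v0 by (auto intro!: order_tendstoD[OF lim[OF diff(2)]]
        simp del: less_divide_eq_numeral1 divide_less_eq_numeral1)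
  moreover have "\<forall>\<^sub>F r in at_right 0. 0 < e r" "\<forall>\<^sub>F r in at_right 0. e r < e 0 + 1"
    using \<open>0 < e 0\<close> by (auto intro!: order_tendstoD[OF lim[OF diff(1)]])
  moreover have "\<forall>\<^sub>F r in at_right 0. 0 < 1 + r - t r * r"
  proof (rule order_tendstoD(1))
    show "((\<lambda>r. 1 + r - t r * r) \<longlongrightarrow> 1 + 0 - t 0 * 0) (at_right 0)"
      by (intro tendsto_intros lim[OF diff(3)])
  qed simp
  moreover have "\<forall>\<^sub>F r in at_right 0. 16 * v 0 * r < 1"
  proof (rule order_tendstoD(2))
    show "((\<lambda>r. 16 * v 0 * r) \<longlongrightarrow> 16 * v 0 * 0) (at_right 0)"
      by (intro tendsto_intros)
  qed simp
  ultimately have "\<forall>\<^sub>F r in at_right 0. v 0 / 2 \<le> v r \<and> v r \<le> 2 * v 0 \<and> 0 \<le> e r \<and> e r \<le> e 0 + 1 \<and>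
      0 < 1 + r - t r * r \<and>
      \<bar>t r * r / (1 + r - t r * r) - v r * r + (v r)\<^sup>2 * r\<^sup>2\<bar> \<le> max K1 K2 * r\<^sup>2 \<and>
      (v r)\<^sup>2 / 2 - e r \<le> max K1 K2 * r \<and> 16 * v 0 * r \<le> 1"
    using \<phi> \<psi> eventually_at_right_less[of 0]
  proof eventually_elim
    case (elim r)
    have "t r * r / (1 + r - t r * r) - v r * r + (v r)\<^sup>2 * r\<^sup>2 = \<phi> r * r"
      by (simp add: \<phi>_def power2_eq_square algebra_simps)
    \<comment> \<open>\<open>\<phi> 0 = t 0 - v 0 = 0\<close>, so the cross coefficient
      \<open>\<phi> r * r\<close> is of second order.\<close>
    moreover have "\<bar>\<phi> r\<bar> \<le> K1 * r"
      using elim v0 by (simp add: \<phi>_def)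
    ultimately have "\<bar>t r * r / (1 + r - t r * r) - v r * r + (v r)\<^sup>2 * r\<^sup>2\<bar> \<le> K1 * r * r"
      using elim by (simp add: abs_mult)
    also have "\<dots> \<le> max K1 K2 * r\<^sup>2"
      using elim by (simp add: power2_eq_square mult_right_mono)
    finally have "\<bar>t r * r / (1 + r - t r * r) - v r * r + (v r)\<^sup>2 * r\<^sup>2\<bar> \<le> max K1 K2 * r\<^sup>2" .
    moreover have "K2 * r \<le> max K1 K2 * r"
      using elim by (simp add: mult_right_mono)
    \<comment> \<open>\<open>\<psi> 0 \<le> 0\<close> by \<open>e0\<close>, which gives the upper
      bound only; for \<open>e 0\<close> above the threshold \<open>\<psi>\<close> stays negative
      near 0.\<close>
    then have "(v r)\<^sup>2 / 2 - e r \<le> max K1 K2 * r"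
      using elim e0 unfolding \<psi>_def by linarith
    ultimately show ?case
      using elim by auto
  qed
  then obtain b where b: "b > 0" "\<And>r. r > 0 \<Longrightarrow> r < b \<Longrightarrow>
      v 0 / 2 \<le> v r \<and> v r \<le> 2 * v 0 \<and> 0 \<le> e r \<and> e r \<le> e 0 + 1 \<and>
      0 < 1 + r - t r * r \<and>
      \<bar>t r * r / (1 + r - t r * r) - v r * r + (v r)\<^sup>2 * r\<^sup>2\<bar> \<le> max K1 K2 * r\<^sup>2 \<and>
      (v r)\<^sup>2 / 2 - e r \<le> max K1 K2 * r \<and> 16 * v 0 * r \<le> 1"
    unfolding eventually_at_right_field by blast
  show ?thesis
    by (rule that[of "max K1 K2" b]) (use b K1 in auto)
qed

section \<open>Structure of the iterates\<close>

lemma algorithm_A_in_Rn: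
  assumes "algorithm_A (grad n f) \<mu> s \<eta> \<nu> \<tau> x0 x y z" "f differentiable_on Rn n" "x0 \<in> Rn n"
  shows "x k \<in> Rn n \<and> z k \<in> Rn n"
proof (induction k)
  case 0
  then show ?case
    using assms by (simp add: algorithm_A_def Let_def)
next
  case (Suc k)
  then have "grad n f (x k) \<in> Rn n"
    using grad_has_derivative assms by blast
  with Suc show ?case
    using assms(1) subspace_Rn[of n]
    by (simp add: algorithm_A_def Let_def subspace_add subspace_diff subspace_scale)
qed

text \<open>Eliminates \<open>y\<close>. Measuring the convex-combination step from its endpoint
  \<open>x (Suc k)\<close> replaces the weight \<open>c\<close> by \<open>c / (1 - c)\<close>, and
  the displacement is expressed by the same difference that drives the next update of
  \<open>z\<close>.\<close>

lemma algorithm_A_displacement: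
  assumes alg: "algorithm_A G \<mu> s \<eta> \<nu> \<tau> x0 x y z" and r: "r = sqrt (\<mu> * s)" "0 \<le> r"
    and "0 < 1 + r - \<tau> * r"
  shows "x (Suc k) - x k =
    (\<tau> * r / (1 + r - \<tau> * r)) *\<^sub>R (z (Suc k) - x (Suc k)) - (\<eta> * s) *\<^sub>R G (x k)"
proof -
  define c where "c = \<tau> * r / (1 + r)"
  have c: "1 - c = (1 + r - \<tau> * r) / (1 + r)"
    using r(2) by (simp add: c_def field_simps)
  then have "c \<noteq> 1" and \<rho>: "\<tau> * r / (1 + r - \<tau> * r) = c / (1 - c)"
    using assms by (auto simp: c_def)
  have y: "y (Suc k) = x k - (\<eta> * s) *\<^sub>R G (x k)"
    and x: "x (Suc k) = c *\<^sub>R z (Suc k) + (1 - c) *\<^sub>R y (Suc k)"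
    using alg r(1) by (auto simp: algorithm_A_def Let_def c_def)
  have "(1 - c) *\<^sub>R (x (Suc k) - y (Suc k)) = c *\<^sub>R (z (Suc k) - x (Suc k))"
    unfolding x by (simp add: algebra_simps)
  then have "x (Suc k) - y (Suc k) = (c / (1 - c)) *\<^sub>R (z (Suc k) - x (Suc k))"
    using \<open>c \<noteq> 1\<close> by (metis (no_types, opaque_lifting) divide_inverse_commute eq_iff_diff_eq_0
        real_vector_affinity_eq scaleR_scaleR vector_fraction_eq_iff)
  then show ?thesis
    unfolding \<rho> y by (simp add: algebra_simps)
qed

section \<open>Uniform rate for stepsizes up to \<open>C0 / L\<close>\<close>

lemma linear_rate_small_step:
  fixes e v t :: "real \<Rightarrow> real"
  assumes "e differentiable (at 0)" "v differentiable (at 0)" "t differentiable (at 0)"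
    and "0 < v 0" "v 0 = t 0" "(v 0)\<^sup>2 / 2 \<le> e 0"
  obtains C0 where "0 < C0" "linear_rate e v t (\<lambda>\<mu> L. C0 / L) 5 (v 0 / 56)"
proof -
  define N where "N = v 0"
  obtain K \<delta> where "0 \<le> K" "0 < \<delta>" and par:
    "\<And>r. 0 < r \<Longrightarrow> r < \<delta> \<Longrightarrow> N / 2 \<le> v r \<and> v r \<le> 2 * N \<and> 0 \<le> e r \<and> e r \<le> e 0 + 1 \<and>
      0 < 1 + r - t r * r \<and>
      \<bar>t r * r / (1 + r - t r * r) - v r * r + (v r)\<^sup>2 * r\<^sup>2\<bar> \<le> K * r\<^sup>2 \<and>
      (v r)\<^sup>2 / 2 - e r \<le> K * r \<and> 16 * N * r \<le> 1"
    unfolding N_def by (rule parameter_error_bounds[OF assms]) blast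
  define A where "A = 8 * (2 * K\<^sup>2 / N + K)"
  \<comment> \<open>Since \<open>\<mu> * s \<le> L * s \<le> C0\<close>, the first entry keeps
    \<open>r\<close> below \<open>\<delta>\<close>. The second gives
    \<open>\<eta> * s * L \<le> 1 / 2\<close>, as \<eta> is at most \<open>e 0 + 1\<close>; the last
    two are the smallness conditions of \<open>lyapunov_contraction\<close>. The 1 added to
    \<open>A\<close> covers \<open>A = 0\<close>.\<close>
  define C0 where "C0 = Min {(\<delta> / 2)\<^sup>2, 1 / (2 * (e 0 + 1)), N / (A + 1), 1 / (4 * N\<^sup>2)}"
  have N: "0 < N" and e0: "0 \<le> e 0"
    using assms unfolding N_def by (auto intro: order_trans[OF _ assms(6)])
  have A: "0 \<le> A"
    using N \<open>0 \<le> K\<close> by (simp add: A_def)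
  have C0: "0 < C0"
    using N e0 A \<open>0 < \<delta>\<close> by (simp add: C0_def)
  have "C0 \<le> (\<delta> / 2)\<^sup>2" "C0 \<le> 1 / (2 * (e 0 + 1))" "C0 \<le> N / (A + 1)" "C0 \<le> 1 / (4 * N\<^sup>2)"
    by (simp_all add: C0_def)
  then have C0_le: "C0 \<le> (\<delta> / 2)\<^sup>2" "(e 0 + 1) * C0 \<le> 1 / 2" "(A + 1) * C0 \<le> N" "4 * N\<^sup>2 * C0 \<le> 1"
    using N e0 A by (simp_all add: field_simps)
  have "f (x k) - f xs \<le> 5 * L * (norm (x0 - xs))\<^sup>2 * (1 - N / 56 * sqrt (\<mu> * s)) ^ k"
    if \<mu>: "0 < \<mu>" "\<mu> \<le> L" and f: "f \<in> smooth_strongly_convex n \<mu> L"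
      and min: "is_arg_min f (\<lambda>u. u \<in> Rn n) xs" and x0: "x0 \<in> Rn n"
      and s: "0 < s" "s \<le> C0 / L"
      and alg: "algorithm_A (grad n f) \<mu> s (e (sqrt (\<mu> * s))) (v (sqrt (\<mu> * s))) (t (sqrt (\<mu> * s)))
          x0 x y z"
    for n \<mu> L f xs x0 s x y z k
  proof -
    define r where "r = sqrt (\<mu> * s)"
    define \<eta> \<nu> \<tau> where "\<eta> = e r" and "\<nu> = v r" and "\<tau> = t r"
    define g where "g k = grad n f (x k)" for k
    define F where "F k = f (x k) - f xs" for k
    \<comment> \<open>The index shift in \<open>z\<close> makes \<open>E 0\<close> involve
      \<open>z 1\<close>, which already contains the gradient at \<open>x0\<close>.\<close>
    define E where "E k = F k - \<eta> * s / 2 * (norm (g k))\<^sup>2 + \<mu> / 2 * (norm (z (Suc k) - xs))\<^sup>2" for k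
    have L: "0 < L"
      using \<mu> by simp
    have Ls: "L * s \<le> C0"
      using s L by (simp add: field_simps)
    have r2: "r\<^sup>2 = \<mu> * s" and r_pos: "0 < r"
      using \<mu> s by (simp_all add: r_def)
    have "\<mu> * s \<le> (\<delta> / 2)\<^sup>2"
      using mult_right_mono[OF \<mu>(2), of s] s Ls C0_le(1) by linarith
    then have "r \<le> \<delta> / 2"
      unfolding r_def using \<open>0 < \<delta>\<close> by (intro real_le_lsqrt) auto
    then have "r < \<delta>"
      using \<open>0 < \<delta>\<close> by simp
    note par = par[OF r_pos this, folded \<eta>_def \<nu>_def \<tau>_def]
    have alg': "algorithm_A (grad n f) \<mu> s \<eta> \<nu> \<tau> x0 x y z"
      using alg by (simp add: \<eta>_def \<nu>_def \<tau>_def r_def)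
    have diff: "f differentiable_on Rn n"
      and lip: "\<And>u w. u \<in> Rn n \<Longrightarrow> w \<in> Rn n \<Longrightarrow> norm (grad n f w - grad n f u) \<le> L * norm (w - u)"
      and sc: "\<And>u w. u \<in> Rn n \<Longrightarrow> w \<in> Rn n \<Longrightarrow>
          f u + inner (grad n f u) (w - u) + \<mu> / 2 * (norm (w - u))\<^sup>2 \<le> f w"
      using f unfolding smooth_strongly_convex_def by auto
    have xs: "xs \<in> Rn n"
      using min by (simp add: is_arg_min_def)
    have x: "x k \<in> Rn n" for k
      using algorithm_A_in_Rn[OF alg' diff x0] by simp
    have grad_xs: "grad n f xs = 0"
      using grad_norm_le_gap[OF f L min xs] by simp
    have gF: "(norm (g k))\<^sup>2 \<le> 2 * L * F k" for k
      unfolding g_def F_def by (rule grad_norm_le_gap[OF f L min x])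
    have F: "0 \<le> F k" for k
      using min x by (simp add: F_def is_arg_min_def not_less)
    have zSuc: "z (Suc k) - xs = (z k - xs) + (\<nu> * r) *\<^sub>R ((x k - xs) - (z k - xs)) - (\<nu> * r / \<mu>) *\<^sub>R g k" for k
      using alg' by (simp add: algorithm_A_def Let_def r_def g_def algebra_simps)
    have "\<eta> * (s * L) \<le> (e 0 + 1) * C0"
      using par Ls s L by (intro mult_mono) (auto simp: mult.commute)
    then have \<eta>: "\<eta> * s * L \<le> 1 / 2"
      using C0_le by (simp add: mult.assoc)
    have "A * (L * s) \<le> (A + 1) * C0"
      using Ls A s L by (intro mult_mono) auto
    then have ALs: "8 * (2 * K\<^sup>2 / N + K) * (L * s) \<le> N"
      using C0_le by (simp add: A_def)
    have "4 * N\<^sup>2 * (L * s) \<le> 4 * N\<^sup>2 * C0"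
      using Ls by (intro mult_left_mono) auto
    then have NLs: "4 * N\<^sup>2 * (L * s) \<le> 1"
      using C0_le by simp
    have step: "E (Suc k) \<le> (1 - N / 56 * r) * E k" for k
      unfolding E_def
    proof (rule lyapunov_contraction[where X = "x (Suc k) - xs" and K = K and L = L and \<nu> = \<nu>
          and \<rho> = "\<tau> * r / (1 + r - \<tau> * r)"])
      have "inner (g (Suc k)) (x (Suc k) - x k)
          = \<tau> * r / (1 + r - \<tau> * r) * inner (g (Suc k)) (z (Suc k) - x (Suc k))
            - \<eta> * s * inner (g (Suc k)) (g k)"
        using algorithm_A_displacement[OF alg' r_def, of k] par r_pos
        by (simp add: inner_diff_right g_def)
      then show "F (Suc k) - F k \<le> \<tau> * r / (1 + r - \<tau> * r)
            * inner (g (Suc k)) (z (Suc k) - xs - (x (Suc k) - xs))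
          - \<eta> * s * inner (g (Suc k)) (g k) - (norm (g (Suc k) - g k))\<^sup>2 / (2 * L)"
        using grad_cocoercive[OF f _ L x x, of "Suc k" k] \<mu> by (simp add: F_def g_def)
      show "F (Suc k) + \<mu> / 2 * (norm (x (Suc k) - xs))\<^sup>2 \<le> inner (g (Suc k)) (x (Suc k) - xs)"
        using sc[OF x xs, of "Suc k"]
        by (simp add: F_def g_def inner_diff_right norm_minus_commute algebra_simps)
      show "\<mu> / 2 * (norm (x (Suc k) - xs))\<^sup>2 \<le> F (Suc k)"
        using sc[OF xs x, of "Suc k"] by (simp add: F_def grad_xs)
    qed (use \<mu> L N r_pos s \<open>0 \<le> K\<close> r2 \<eta> par gF zSuc ALs NLs in simp_all)
    have rate: "0 \<le> 1 - N / 56 * r"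
      using par N r_pos by auto
    have Ek: "E k \<le> (1 - N / 56 * r) ^ k * E 0" for k
    proof (induction k)
      case (Suc k)
      then show ?case
        using step[of k] mult_left_mono[OF Suc rate] by (simp add: mult.assoc)
    qed simp
    \<comment> \<open>The gradient correction is at most half of the gap, whence the factor
      2.\<close>
    have FE: "F k \<le> 2 * E k" for k
    proof -
      have "\<eta> * s / 2 * (norm (g k))\<^sup>2 \<le> \<eta> * s / 2 * (2 * L * F k)"
        using gF par s by (intro mult_left_mono) auto
      also have "\<dots> = \<eta> * s * L * F k"
        by simp
      also have "\<dots> \<le> 1 / 2 * F k"
        using \<eta> F by (intro mult_right_mono) auto
      finally have "F k / 2 + \<mu> / 2 * (norm (z (Suc k) - xs))\<^sup>2 \<le> E k"
        by (simp add: E_def)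
      moreover have "0 \<le> \<mu> / 2 * (norm (z (Suc k) - xs))\<^sup>2"
        using \<mu> by simp
      ultimately show ?thesis
        by linarith
    qed
    \<comment> \<open>5/2 = 1/2 + 2: the gap contributes \<open>L / 2\<close>. The distance of
      \<open>z 1\<close> contributes \<open>\<mu> \<le> L\<close> from the starting point and
      another \<open>L\<close> from its gradient step, by \<open>NLs\<close>.\<close>
    have E0: "E 0 \<le> 5 / 2 * L * (norm (x0 - xs))\<^sup>2"
    proof -
      define R where "R = (norm (x0 - xs))\<^sup>2"
      have init: "x 0 = x0" "z 0 = x0"
        using alg' by (simp_all add: algorithm_A_def Let_def)
      have R: "0 \<le> R"
        by (simp add: R_def)
      have F0: "F 0 \<le> L / 2 * R"
        using descent_lemma[OF f xs x, of 0] by (simp add: F_def R_def init grad_xs)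
      have "norm (g 0) \<le> L * norm (x0 - xs)"
        using lip[OF xs x, of 0] by (simp add: g_def grad_xs init)
      then have g0: "(norm (g 0))\<^sup>2 \<le> L\<^sup>2 * R"
        unfolding R_def power_mult_distrib[symmetric] by (rule power_mono) simp
      let ?h = "(\<nu> * r / \<mu>) *\<^sub>R g 0"
      have "z (Suc 0) - xs = (x0 - xs) - ?h"
        using zSuc[of 0] by (simp add: init)
      then have "(norm (z (Suc 0) - xs))\<^sup>2 \<le> 2 * (R + (norm ?h)\<^sup>2)"
        unfolding R_def using norm_diff_square_le by metis
      then have "\<mu> / 2 * (norm (z (Suc 0) - xs))\<^sup>2 \<le> \<mu> / 2 * (2 * (R + (norm ?h)\<^sup>2))"
        using \<mu> by (intro mult_left_mono) auto
      also have "\<dots> = \<mu> * R + \<mu> * (norm ?h)\<^sup>2"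
        by (simp add: algebra_simps)
      also have "(norm ?h)\<^sup>2 = \<nu>\<^sup>2 * (\<mu> * s) / \<mu>\<^sup>2 * (norm (g 0))\<^sup>2"
        by (simp add: power_mult_distrib power_divide r2)
      also have "\<mu> * \<dots> = \<nu>\<^sup>2 * s * (norm (g 0))\<^sup>2"
        using \<mu> by (simp add: power2_eq_square)
      also have "\<dots> \<le> (2 * N)\<^sup>2 * s * (L\<^sup>2 * R)"
        using par g0 s N by (intro mult_mono power_mono) auto
      also have "\<dots> = 4 * N\<^sup>2 * (L * s) * (L * R)"
        by (simp add: power2_eq_square)
      also have "\<dots> \<le> 1 * (L * R)"
        using NLs L R by (intro mult_right_mono) auto
      also have "\<mu> * R \<le> L * R"
        using \<mu> R by (intro mult_right_mono) auto
      finally have "\<mu> / 2 * (norm (z (Suc 0) - xs))\<^sup>2 \<le> 2 * (L * R)"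
        by simp
      moreover have "0 \<le> \<eta> * s / 2 * (norm (g 0))\<^sup>2"
        using par s by simp
      ultimately have "E 0 \<le> 5 / 2 * (L * R)"
        using F0 by (simp add: E_def)
      then show ?thesis
        by (simp add: R_def mult.assoc)
    qed
    have "F k \<le> 2 * ((1 - N / 56 * r) ^ k * E 0)"
      using FE[of k] Ek[of k] by linarith
    also have "\<dots> \<le> 2 * ((1 - N / 56 * r) ^ k * (5 / 2 * L * (norm (x0 - xs))\<^sup>2))"
      using E0 rate by (intro mult_left_mono) auto
    finally show ?thesis
      by (simp add: F_def r_def mult_ac)
  qed
  then have "linear_rate e v t (\<lambda>\<mu> L. C0 / L) 5 (v 0 / 56)"
    unfolding linear_rate_def N_def by blast
  then show ?thesis
    using that C0 by blast
qed

section \<open>The two stepsize ranges\<close>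

lemma linear_rate_mono:
  assumes "linear_rate e v t smax C C1"
    and "\<And>\<mu> L. 0 < \<mu> \<Longrightarrow> \<mu> \<le> L \<Longrightarrow> smax' \<mu> L \<le> smax \<mu> L"
  shows "linear_rate e v t smax' C C1"
  unfolding linear_rate_def
proof (intro allI impI, elim conjE)
  fix n \<mu> L f xs x0 s x y z and k :: nat
  assume *: "0 < \<mu>" "\<mu> \<le> L" "f \<in> smooth_strongly_convex n \<mu> L"
    "is_arg_min f (\<lambda>u. u \<in> Rn n) xs" "x0 \<in> Rn n" "0 < s"
    "algorithm_A (grad n f) \<mu> s (e (sqrt (\<mu> * s))) (v (sqrt (\<mu> * s))) (t (sqrt (\<mu> * s))) x0 x y z"
    "1 \<le> k" and "s \<le> smax' \<mu> L"
  then have "s \<le> smax \<mu> L"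
    using assms(2)[of \<mu> L] by linarith
  with * show "f (x k) - f xs \<le> C * L * (norm (x0 - xs))\<^sup>2 * (1 - C1 * sqrt (\<mu> * s)) ^ k"
    using assms(1) unfolding linear_rate_def by blast
qed

theorem theorem3:
  fixes e v t :: "real \<Rightarrow> real" and \<eta> \<nu> \<tau> :: "nat \<Rightarrow> real"
  assumes "\<forall>\<^sub>F r in nhds 0. 0 \<le> e r" "\<forall>\<^sub>F r in nhds 0. 0 \<le> v r" "\<forall>\<^sub>F r in nhds 0. 0 \<le> t r"
    and "e has_fps_expansion Abs_fps \<eta>" "v has_fps_expansion Abs_fps \<nu>" "t has_fps_expansion Abs_fps \<tau>"
    and "0 < \<nu> 0" "\<nu> 0 = \<tau> 0" "\<eta> 0 \<ge> (\<tau> 0)\<^sup>2 / 2"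
  shows
    "(\<eta> 0 = (\<tau> 0)\<^sup>2 / 2 \<and>
      \<nu> 1 - \<tau> 1 < \<tau> 0 * (\<tau> 0 / 2 - 1) \<and>
      2 * \<eta> 1 < \<nu> 1 * \<tau> 1 + (\<tau> 0)\<^sup>2 / 2 * (5 / 2 * \<tau> 0 - 2)
      \<longrightarrow> (\<exists>C>0. \<exists>C0>0. \<exists>C1>0. linear_rate e v t (\<lambda>\<mu> L. C0 * \<mu> / L\<^sup>2) C C1))
   \<and> ((\<eta> 0 = (\<tau> 0)\<^sup>2 / 2 \<and>
       \<nu> 1 - \<tau> 1 < \<tau> 0 * (\<tau> 0 / 2 - 1) \<and>
       2 * \<eta> 1 \<ge> \<nu> 1 * \<tau> 1 + (\<tau> 0)\<^sup>2 / 2 * (5 / 2 * \<tau> 0 - 2)) \<or>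
      (\<eta> 0 > (\<tau> 0)\<^sup>2 / 2 \<and>
       \<nu> 1 - \<tau> 1 < (\<tau> 0 - 1) * \<tau> 0 - \<eta> 0) \<or>
      (\<eta> 0 > (\<tau> 0)\<^sup>2 / 2 \<and>
       (\<tau> 0 - 1) * \<tau> 0 - \<eta> 0 < \<nu> 1 - \<tau> 1 \<and>
       \<nu> 1 - \<tau> 1 < \<eta> 0 - \<tau> 0)
      \<longrightarrow> (\<exists>C>0. \<exists>C0>0. \<exists>C1>0. linear_rate e v t (\<lambda>\<mu> L. C0 / L) C C1))"
proof -
  have "v 0 = \<nu> 0" "t 0 = \<tau> 0" "e 0 = \<eta> 0"
    using assms(4-6)[THEN has_fps_expansion_imp_value_0] by simp_all
  then have "0 < v 0" "v 0 = t 0" "(v 0)\<^sup>2 / 2 \<le> e 0"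
    using assms by simp_all
  then obtain C0 where "0 < C0" and large: "linear_rate e v t (\<lambda>\<mu> L. C0 / L) 5 (v 0 / 56)"
    using linear_rate_small_step assms(4-6)[THEN has_fps_expansion_imp_differentiable] by metis
  \<comment> \<open>Since \<open>\<mu> \<le> L\<close>, the range
    \<open>s \<le> C0 * \<mu> / L^2\<close> lies inside \<open>s \<le> C0 / L\<close>, so the same
    constants serve both parts.\<close>
  have "linear_rate e v t (\<lambda>\<mu> L. C0 * \<mu> / L\<^sup>2) 5 (v 0 / 56)"
    using large by (rule linear_rate_mono) (use \<open>0 < C0\<close> in \<open>simp add: field_simps power2_eq_square\<close>)
  moreover have "(5::real) > 0" "v 0 / 56 > 0"
    using \<open>0 < v 0\<close> by simp_all
  ultimately show ?thesis
    using large \<open>0 < C0\<close> by blast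
qed

end
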